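(* Let $\lambda$ be the unique real root of $\lambda^3-\lambda^2-\lambda-1=0$, and let $F:[0,1]\to[0,1]$ be the limit distribution function $F(x)=\lim_{n\to\infty}F_n(x)$ associated with odd continued fractions. For all $x\in[0,1]$ and all integers $n\ge 1$, $$\frac{1-F(1-x)}{\lambda^{2n-1}}=\frac{1}{\lambda^{2n-2}}-1+F\left(1-\frac{1}{2n-1+x}\right),$$ $$\frac{1-F(1-x)}{\lambda^{2n}}=1-F\left(1-\frac{1}{2n+\frac1x}\right),$$ where for $x=0$ the expression $\frac{1}{2n+1/x}$ is read as $0$.
   Context: Odd continued fraction representation: every rational $x\in[0,1]$ is written uniquely as $$x=\left[1;\frac{\varepsilon_1}{a_1},\ldots,\frac{\varepsilon_l}{a_l}\right]=1+\cfrac{\varepsilon_1}{a_1+\cfrac{\varepsilon_2}{a_2+\cdots+\cfrac{\varepsilon_l}{a_l}}},$$ where all $a_i$ are odd positive integers, $\varepsilon_i\in\{1,-1\}$, $\varepsilon_1=-1$, and $a_j+\varepsilon_{j+1}\ge 2$ for $1\le j<l$; moreover, if the last partial quotient is $a_l=1$ with $l\ge 2$, then $\varepsilon_l=1$. (The number $x=1$ has $l=0$; the number $x=0$ is $\left[1;\frac{-1}{1}\right]$.) For rational $x\in[0,1]$ put $S(x)=\sum_{j=1}^{l}a_j$. For $n\ge1$ let $\mathcal{M}_n=\{x\in\mathbb{Q}\cap[0,1]: S(x)\le n+1\}$, which is a finite set, and $$F_n(x)=\frac{\#\{\xi\in\mathcal{M}_n:\xi\le x\}}{\#\mathcal{M}_n},\qquad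 x\in[0,1].$$ The limit $F(x)=\lim_{n\to\infty}F_n(x)$ exists for every $x\in[0,1]$. *)

theory Defs
  imports "HOL-Analysis.Analysis"
begin

(* A word [(e_1, a_1), ..., (e_l, a_l)] stands for the continued fraction
   [1; e_1/a_1, ..., e_l/a_l]. *)

fun ocf_tail :: "(int \<times> nat) list \<Rightarrow> real" where
  "ocf_tail [] = 0"
| "ocf_tail ((e, a) # ws) = of_int e / (of_nat a + ocf_tail ws)"

definition ocf_value :: "(int \<times> nat) list \<Rightarrow> real" where
  "ocf_value ws = 1 + ocf_tail ws"

(* Indices are shifted: ws ! j holds (e_(j+1), a_(j+1)). *)
definition ocf_admissible :: "(int \<times> nat) list \<Rightarrow> bool" where
  "ocf_admissible ws \<longleftrightarrow>
     (\<forall>(e, a) \<in> set ws. (e = 1 \<or> e = -1) \<and> odd a) \<and>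
     (ws \<noteq> [] \<longrightarrow> fst (ws ! 0) = -1) \<and>
     (\<forall>j. Suc j < length ws \<longrightarrow> int (snd (ws ! j)) + fst (ws ! Suc j) \<ge> 2) \<and>
     (length ws \<ge> 2 \<and> snd (last ws) = 1 \<longrightarrow> fst (last ws) = 1)"

(* Meaningful for rational x in [0,1], where exactly one admissible word has value x. *)
definition ocf_word :: "real \<Rightarrow> (int \<times> nat) list" where
  "ocf_word x = (THE ws. ocf_admissible ws \<and> ocf_value ws = x)"

definition ocf_sum :: "real \<Rightarrow> nat" where
  "ocf_sum x = sum_list (map snd (ocf_word x))"

definition ocf_set :: "nat \<Rightarrow> real set" where
  "ocf_set n = {x \<in> \<rat> \<inter> {0..1}. ocf_sum x \<le> n + 1}"

definition ocf_dist_approx :: "nat \<Rightarrow> real \<Rightarrow> real" where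
  "ocf_dist_approx n x =
     real (card {\<xi> \<in> ocf_set n. \<xi> \<le> x}) / real (card (ocf_set n))"

definition ocf_dist :: "real \<Rightarrow> real" where
  "ocf_dist x = lim (\<lambda>n. ocf_dist_approx n x)"

end

theory Submission
  imports Defs
begin

text \<open>
  Write \<open>\<xi> = 1 - y\<close>, and let \<open>S y\<close> be the digit sum of \<open>1 - y\<close>. Every rational \<open>y\<close> in
  \<open>[0, 1]\<close> other than \<open>0\<close> lies in the range of one of the three maps
  \<open>1 / (1 + y)\<close>, \<open>1 / (3 - y)\<close>, \<open>y / (1 + 2 y)\<close>, onto \<open>[1/2, 1]\<close>, \<open>[1/3, 1/2]\<close>, \<open>[0, 1/3]\<close>;
  apart from the exceptions \<open>y = 1\<close> for the second and \<open>y = 0\<close> for the third they raise \<open>S\<close> by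
  \<open>1\<close>, \<open>3\<close>, \<open>2\<close>. Counting the points with \<open>S \<le> m\<close> therefore leads to
  the tribonacci recurrence, so these counts grow like a constant times \<open>\<lambda>\<close> to the power \<open>m\<close>.
  The same maps express the rescaled counts of points below \<open>x\<close> by those of a preimage of \<open>x\<close>,
  with a factor of modulus at most \<open>1 / \<lambda>\<close>; iterating, the oscillation of the
  rescaled counts tends to \<open>0\<close>, and the limit \<open>F\<close> exists. Then \<open>G x = 1 - F (1 - x)\<close> satisfies
  \<open>G (1 / (1 + x)) = 1 - G x / \<lambda>\<close> and \<open>G (x / (1 + 2 x)) = G x / \<lambda>\<^sup>2\<close>, and both identities
  follow since the \<open>n\<close>-th iterate of the third map sends \<open>1 / s\<close> to \<open>1 / (2 n + s)\<close>.
\<close>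

section \<open>Uniqueness of odd continued fractions\<close>

lemma ocf_admissible_Nil: "ocf_admissible []"
  by (simp add: ocf_admissible_def)

lemma ocf_admissible_single: "ocf_admissible [(e, a)] \<longleftrightarrow> e = -1 \<and> odd a"
  by (auto simp: ocf_admissible_def)

text \<open>Peels off the first letter so that inductions can run on words. The sign
  \<open>d\<close> becomes -1 because an admissible word must start that way. The last conjunct
  keeps the rule on a final partial quotient 1, which the shortened word no longer records once it
  has length one.\<close>

lemma ocf_admissible_Cons_Cons:
  "ocf_admissible ((e, a) # (d, b) # us) \<longleftrightarrow>
     e = -1 \<and> odd a \<and> (d = 1 \<or> d = -1) \<and> int a + d \<ge> 2 \<and>
     ocf_admissible ((-1, b) # us) \<and> (us = [] \<and> b = 1 \<longrightarrow> d = 1)"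
proof -
  have all_Suc: "(\<forall>j. Q j) \<longleftrightarrow> Q 0 \<and> (\<forall>j. Q (Suc j))" for Q :: "nat \<Rightarrow> bool"
    by (metis not0_implies_Suc)
  \<comment> \<open>Along the tail, the adjacency condition reads signs only from the second letter
    on, so changing the head sign leaves it intact.\<close>
  have snd_nth: "snd (((d, b) # us) ! j) = snd (((-1, b) # us) ! j)" for j
    by (cases j) auto
  have "(\<forall>j. Suc j < length ((e, a) # (d, b) # us) \<longrightarrow>
          int (snd (((e, a) # (d, b) # us) ! j)) + fst (((e, a) # (d, b) # us) ! Suc j) \<ge> 2)
    \<longleftrightarrow> int a + d \<ge> 2 \<and>
      (\<forall>j. Suc j < length ((-1, b) # us) \<longrightarrow>
          int (snd (((-1, b) # us) ! j)) + fst (((-1, b) # us) ! Suc j) \<ge> 2)"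
    by (subst all_Suc) (simp add: snd_nth)
  then show ?thesis
    unfolding ocf_admissible_def by (cases us) auto
qed

text \<open>Every denominator is at least 1, so every tail has modulus at most 1. The equality
  clause makes the lower bound -1 strict: a tail -1 would need a final -1/1, which admissibility
  excludes.\<close>

lemma ocf_tail_bounds:
  assumes "ocf_admissible ((-1, a) # vs)"
  shows "-1 < ocf_tail vs \<and> ocf_tail vs \<le> 1 \<and> 1 \<le> real a + ocf_tail vs \<and>
         (real a + ocf_tail vs = 1 \<longrightarrow> a = 1 \<and> vs = [])"
  using assms
proof (induction vs arbitrary: a)
  case Nil
  then show ?case
    by (auto simp: ocf_admissible_single elim!: oddE)
next
  case (Cons w us)
  obtain d b where w: "w = (d, b)" by force
  note adm = Cons.prems[unfolded w ocf_admissible_Cons_Cons]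
  define t where "t = real b + ocf_tail us"
  have t: "t \<ge> 1" "t = 1 \<Longrightarrow> b = 1 \<and> us = []"
    using Cons.IH[of b] adm by (auto simp: t_def)
  define r where "r = 1 / t"
  have inv: "0 < r" "r \<le> 1" using t(1) by (auto simp: r_def)
  have eq: "ocf_tail (w # us) = of_int d * r" by (simp add: w t_def r_def)
  show ?case
  proof (cases "d = 1")
    case True
    moreover have "a \<ge> 1" using adm by (auto elim!: oddE)
    ultimately show ?thesis using inv unfolding eq by auto
  next
    case False
    then have d: "d = -1" using adm by auto
    then have "t \<noteq> 1" using adm t(2) by auto
    then have "r < 1" using t(1) by (auto simp: r_def)
    moreover have "a \<ge> 3" using adm d by auto
    ultimately show ?thesis using inv unfolding eq d by auto
  qed
qed

text \<open>Translates of the half-open interval from -1 to 1 by odd integers do not overlap, since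
  odd integers are 2 apart.\<close>

lemma odd_plus_tail_unique:
  fixes s t :: real
  assumes "odd a" "odd b" "-1 < s" "s \<le> 1" "-1 < t" "t \<le> 1" "real a + s = real b + t"
  shows "a = b \<and> s = t"
proof -
  have "\<bar>real a - real b\<bar> < 2" using assms(3-7) by linarith
  then have "\<bar>int a - int b\<bar> < 2" by linarith
  moreover have "even (int a - int b)" using assms(1,2) by simp
  ultimately have "a = b" by presburger
  then show ?thesis using assms(7) by simp
qed

lemma ocf_tail_head_unique:
  assumes "ocf_admissible ((-1, a) # vs)" "ocf_admissible ((-1, b) # us)"
    and "real a + ocf_tail vs = real b + ocf_tail us"
  shows "a = b \<and> ocf_tail vs = ocf_tail us"
proof -
  have "odd a" "odd b" using assms(1,2) by (auto simp: ocf_admissible_def)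
  then show ?thesis
    using odd_plus_tail_unique[OF _ _ _ _ _ _ assms(3)]
      ocf_tail_bounds[OF assms(1)] ocf_tail_bounds[OF assms(2)] by blast
qed

text \<open>Digits are recovered one at a time: parity and size fix the partial quotient, the sign
  of the remaining tail fixes the next sign, and its reciprocal is the next denominator.\<close>

lemma ocf_tail_eq_unique:
  assumes "ocf_admissible ((-1, a) # vs)" "ocf_admissible ((-1, b) # us)"
    and "real a + ocf_tail vs = real b + ocf_tail us"
  shows "a = b \<and> vs = us"
  using assms
proof (induction vs arbitrary: a b us)
  case Nil
  note s = ocf_tail_head_unique[OF Nil]
  show ?case
  proof (cases us)
    case (Cons w zs)
    obtain d c where w: "w = (d, c)" by force
    have adm: "d = 1 \<or> d = -1" "ocf_admissible ((-1, c) # zs)"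
      using Nil(2) unfolding Cons w ocf_admissible_Cons_Cons by auto
    have "ocf_tail us \<noteq> 0"
      using adm ocf_tail_bounds[OF adm(2)] by (auto simp: Cons w)
    then show ?thesis using s by simp
  qed (use s in simp)
next
  case (Cons w ws)
  note s = ocf_tail_head_unique[OF Cons.prems]
  obtain d c where w: "w = (d, c)" by force
  have adm: "d = 1 \<or> d = -1" "ocf_admissible ((-1, c) # ws)"
    using Cons.prems(1) unfolding w ocf_admissible_Cons_Cons by auto
  define t where "t = real c + ocf_tail ws"
  have t: "t \<ge> 1" "ocf_tail (w # ws) = of_int d / t"
    using ocf_tail_bounds[OF adm(2)] by (auto simp: w t_def)
  show ?case
  proof (cases us)
    case Nil
    then show ?thesis using s t adm by auto
  next
    case us: (Cons z zs)
    obtain d' c' where z: "z = (d', c')" by force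
    have adm': "d' = 1 \<or> d' = -1" "ocf_admissible ((-1, c') # zs)"
      using Cons.prems(2) unfolding us z ocf_admissible_Cons_Cons by auto
    define t' where "t' = real c' + ocf_tail zs"
    have t': "t' \<ge> 1" "ocf_tail us = of_int d' / t'"
      using ocf_tail_bounds[OF adm'(2)] by (auto simp: z us t'_def)
    have eq: "of_int d / t = of_int d' / t'" using s t t' by simp
    have "0 < 1 / t" "0 < 1 / t'" using t t' by auto
    then have d: "d = d'"
      using eq adm(1) adm'(1) \<open>0 < 1 / t\<close> \<open>0 < 1 / t'\<close>
      by (metis divide_minus_left less_asym neg_0_less_iff_less of_int_1 of_int_minus)
    then have "t = t'" using eq adm(1) t t' by auto
    then have "c = c' \<and> ws = zs"
      using Cons.IH[OF adm(2) adm'(2)] by (simp add: t_def t'_def)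
    then show ?thesis using s d by (simp add: w us z)
  qed
qed

lemma ocf_admissible_Cons_fst:
  "ocf_admissible ((e, a) # vs) \<Longrightarrow> e = -1"
  by (simp add: ocf_admissible_def)

lemma ocf_value_inj:
  assumes "ocf_admissible vs" "ocf_admissible us" "ocf_value vs = ocf_value us"
  shows "vs = us"
proof -
  have nonzero: "ocf_tail ws \<noteq> 0" if adm: "ocf_admissible ws" and "ws \<noteq> []" for ws
  proof -
    obtain e a zs where ws: "ws = (e, a) # zs" using \<open>ws \<noteq> []\<close> by (cases ws) auto
    then have "e = -1" using adm ocf_admissible_Cons_fst by blast
    then show ?thesis using ocf_tail_bounds[of a zs] adm by (auto simp: ws)
  qed
  show ?thesis
  proof (cases "vs = [] \<or> us = []")
    case True
    then show ?thesis
      using assms nonzero[of vs] nonzero[of us]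
      by (cases "vs = []"; cases "us = []") (auto simp: ocf_value_def)
  next
    case False
    then obtain e a vs' d b us' where eqs: "vs = (e, a) # vs'" "us = (d, b) # us'"
      by (cases vs; cases us) auto
    have e: "e = -1" "d = -1"
      using assms(1,2) eqs ocf_admissible_Cons_fst by blast+
    have "real a + ocf_tail vs' = real b + ocf_tail us'"
      using assms(3) ocf_tail_bounds[of a vs'] ocf_tail_bounds[of b us'] assms(1,2)
      by (simp add: ocf_value_def eqs e)
    then show ?thesis
      using ocf_tail_eq_unique assms(1,2) by (simp add: eqs e)
  qed
qed

section \<open>The three branches\<close>

text \<open>Passing to \<open>1 - y\<close> absorbs the forced leading sign: a nonempty word
  represents the plain reciprocal \<open>1 / (a + ocf_tail vs)\<close>.\<close>

definition ocf_represents :: "(int \<times> nat) list \<Rightarrow> real \<Rightarrow> bool" where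
  "ocf_represents ws y \<longleftrightarrow> ocf_admissible ws \<and> ocf_value ws = 1 - y"

definition ocf_cosum :: "real \<Rightarrow> nat" where
  "ocf_cosum y = ocf_sum (1 - y)"

text \<open>Uniqueness resolves the \<open>THE\<close> in \<open>ocf_word\<close>, so any
  representing word computes the digit sum.\<close>

lemma ocf_represents_cosum:
  assumes "ocf_represents ws y"
  shows "ocf_cosum y = sum_list (map snd ws)"
proof -
  have "ocf_word (1 - y) = ws"
    unfolding ocf_word_def
    by (rule the_equality) (use assms ocf_value_inj in \<open>auto simp: ocf_represents_def\<close>)
  then show ?thesis by (simp add: ocf_cosum_def ocf_sum_def)
qed

lemma ocf_represents_Nil: "ocf_represents [] y \<longleftrightarrow> y = 0"
  by (auto simp: ocf_represents_def ocf_value_def ocf_admissible_Nil)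

lemma ocf_represents_Cons:
  "ocf_represents ((e, a) # vs) y \<longleftrightarrow>
     ocf_admissible ((e, a) # vs) \<and> y = 1 / (real a + ocf_tail vs)"
  using ocf_admissible_Cons_fst[of e a vs]
  by (auto simp: ocf_represents_def ocf_value_def)

text \<open>Prepending a digit turns the old leading sign into \<open>d\<close>. The condition at
  \<open>y = 1\<close> protects the rule on a final partial quotient 1, as the word of 1 is
  \<open>[(-1, 1)]\<close>.\<close>

lemma ocf_represents_Cons_Cons:
  assumes "ocf_represents ((e, b) # us) y" "d = 1 \<or> d = -1" "odd a" "int a + d \<ge> 2"
    "y = 1 \<Longrightarrow> d = 1"
  shows "ocf_represents ((-1, a) # (d, b) # us) (1 / (real a + of_int d * y))"
proof -
  have adm: "ocf_admissible ((-1, b) # us)" and y: "y = 1 / (real b + ocf_tail us)"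
    using assms(1) ocf_admissible_Cons_fst by (auto simp: ocf_represents_Cons)
  show ?thesis
    using assms(2-) adm by (auto simp: ocf_represents_Cons ocf_admissible_Cons_Cons y)
qed

text \<open>The reciprocals of the three maps are \<open>1 + y\<close>, \<open>3 - y\<close> and,
  for nonzero \<open>y\<close>, \<open>2 + 1 / y\<close>. On nonempty words they prepend the digit 1
  with a plus sign after it, prepend 3 with a minus sign after it, or add 2 to the leading
  digit.\<close>

definition branch1 :: "real \<Rightarrow> real" where "branch1 y = 1 / (1 + y)"
definition branch2 :: "real \<Rightarrow> real" where "branch2 y = 1 / (3 - y)"
definition branch3 :: "real \<Rightarrow> real" where "branch3 y = y / (1 + 2 * y)"

lemma ocf_represents_branch1:
  assumes "ocf_represents ws y"
  shows "\<exists>vs. ocf_represents vs (branch1 y) \<and> sum_list (map snd vs) = sum_list (map snd ws) + 1"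
proof (cases ws)
  case Nil
  then have "ocf_represents [(-1, 1)] (branch1 y)"
    using assms by (simp add: ocf_represents_Nil ocf_represents_Cons branch1_def ocf_admissible_single)
  then show ?thesis using Nil by force
next
  case (Cons w us)
  obtain e b where w: "w = (e, b)" by force
  have "ocf_represents ((-1, 1) # (1, b) # us) (branch1 y)"
    using ocf_represents_Cons_Cons[of e b us y 1 1] assms by (simp add: Cons w branch1_def)
  then show ?thesis by (intro exI conjI) (auto simp: Cons w)
qed

lemma ocf_represents_branch2:
  assumes "ocf_represents ws y" "y < 1"
  shows "\<exists>vs. ocf_represents vs (branch2 y) \<and> sum_list (map snd vs) = sum_list (map snd ws) + 3"
proof (cases ws)
  case Nil
  then have "ocf_represents [(-1, 3)] (branch2 y)"
    using assms by (simp add: ocf_represents_Nil ocf_represents_Cons branch2_def ocf_admissible_single)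
  then show ?thesis using Nil by force
next
  case (Cons w us)
  obtain e b where w: "w = (e, b)" by force
  have "ocf_represents ((-1, 3) # (-1, b) # us) (branch2 y)"
    using ocf_represents_Cons_Cons[of e b us y "-1" 3] assms by (simp add: Cons w branch2_def)
  then show ?thesis by (intro exI conjI) (auto simp: Cons w)
qed

lemma ocf_represents_branch3:
  assumes "ocf_represents ws y" "0 < y"
  shows "\<exists>vs. ocf_represents vs (branch3 y) \<and> sum_list (map snd vs) = sum_list (map snd ws) + 2"
proof (cases ws)
  case Nil
  then show ?thesis using assms by (simp add: ocf_represents_Nil)
next
  case (Cons w us)
  obtain e b where w: "w = (e, b)" by force
  have adm: "ocf_admissible ((e, b) # us)" and e: "e = -1"
    and y: "y = 1 / (real b + ocf_tail us)"
    using assms(1) ocf_admissible_Cons_fst by (auto simp: ocf_represents_Cons Cons w)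
  have "ocf_admissible ((-1, b + 2) # us)"
    using adm by (cases us) (auto simp: e ocf_admissible_single ocf_admissible_Cons_Cons)
  moreover have "branch3 y = 1 / (real (b + 2) + ocf_tail us)"
    using ocf_tail_bounds[OF adm[unfolded e]] unfolding y branch3_def by (simp add: field_simps)
  ultimately have "ocf_represents ((-1, b + 2) # us) (branch3 y)"
    by (simp add: ocf_represents_Cons)
  then show ?thesis by (intro exI conjI) (auto simp: Cons w)
qed

section \<open>Inverse branches and descent on the rationals\<close>

lemma branch_Rats:
  assumes "y \<in> \<rat>"
  shows "branch1 y \<in> \<rat>" "branch2 y \<in> \<rat>" "branch3 y \<in> \<rat>"
  using assms by (auto simp: branch1_def branch2_def branch3_def)

lemma branch1_surj:
  assumes "y \<in> {1/2..1}"
  shows "1 / y - 1 \<in> {0..1}" "branch1 (1 / y - 1) = y"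
  using assms by (auto simp: branch1_def field_simps)

lemma branch2_surj:
  assumes "y \<in> {1/3..<1/2}"
  shows "3 - 1 / y \<in> {0..<1}" "branch2 (3 - 1 / y) = y"
  using assms by (auto simp: branch2_def field_simps)

lemma branch3_surj:
  assumes "y \<in> {0<..1/3}"
  shows "y / (1 - 2 * y) \<in> {0<..1}" "branch3 (y / (1 - 2 * y)) = y"
  using assms by (auto simp: branch3_def divide_simps)

text \<open>A Euclidean descent: on a positive fraction \<open>a / b\<close>, the inverse branch
  lowers numerator plus denominator from \<open>a + b\<close> to \<open>b\<close>,
  \<open>4 * a - b\<close> or \<open>b - a\<close>.\<close>

lemma Rats_branch_induct [consumes 2, case_names zero branch1 branch2 branch3]:
  assumes "y \<in> \<rat>" "y \<in> {0..1}"
    and zero: "P 0"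
    and b1: "\<And>y. y \<in> \<rat> \<Longrightarrow> y \<in> {0..1} \<Longrightarrow> P y \<Longrightarrow> P (branch1 y)"
    and b2: "\<And>y. y \<in> \<rat> \<Longrightarrow> y \<in> {0..<1} \<Longrightarrow> P y \<Longrightarrow> P (branch2 y)"
    and b3: "\<And>y. y \<in> \<rat> \<Longrightarrow> y \<in> {0<..1} \<Longrightarrow> P y \<Longrightarrow> P (branch3 y)"
  shows "P y"
proof -
  \<comment> \<open>The fraction need not be reduced, so no coprimality has to be carried
    along.\<close>
  have main: "P (of_int a / of_int b)"
    if "0 \<le> a" "a \<le> b" "0 < b" for a b :: int
    using that
  proof (induction "nat (a + b)" arbitrary: a b rule: less_induct)
    case less
    define y where "y = (of_int a / of_int b :: real)"
    have yQ: "y \<in> \<rat>" by (simp add: y_def)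
    have b0: "real_of_int b > 0" using less.prems by simp
    consider "a = 0" | "a > 0" "y \<in> {1/2..1}" | "a > 0" "y \<in> {1/3..<1/2}"
      | "a > 0" "y \<in> {0<..1/3}"
      using less.prems by (fastforce simp: y_def)
    then show ?case
    proof cases
      case 1
      then show ?thesis using zero by simp
    next
      case 2
      have eq: "1 / y - 1 = of_int (b - a) / of_int a"
        using 2 b0 by (simp add: y_def field_simps)
      have "b \<le> 2 * a" using 2 b0 by (simp add: y_def field_simps)
      then have "P (1 / y - 1)" unfolding eq
        using less.prems 2 by (intro less.hyps) auto
      then show ?thesis
        using b1[of "1 / y - 1"] branch1_surj[OF 2(2)] yQ by (simp add: y_def)
    next
      case 3
      have eq: "3 - 1 / y = of_int (3 * a - b) / of_int a"
        using 3 b0 by (simp add: y_def field_simps)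
      have "real_of_int b \<le> 3 * of_int a" "2 * of_int a < real_of_int b"
        using 3 b0 by (auto simp: y_def field_simps)
      then have "b \<le> 3 * a" "2 * a < b" by linarith+
      then have "P (3 - 1 / y)" unfolding eq
        using less.prems 3 by (intro less.hyps) auto
      then show ?thesis
        using b2[of "3 - 1 / y"] branch2_surj[OF 3(2)] yQ by (simp add: y_def)
    next
      case 4
      have "3 * real_of_int a \<le> of_int b"
        using 4 b0 by (auto simp: y_def field_simps)
      then have ab: "3 * a \<le> b" by linarith
      have eq: "y / (1 - 2 * y) = of_int a / of_int (b - 2 * a)"
        using b0 by (simp add: y_def divide_simps)
      have "P (y / (1 - 2 * y))" unfolding eq
        using less.prems 4 ab by (intro less.hyps) auto
      then show ?thesis
        using b3[of "y / (1 - 2 * y)"] branch3_surj[OF 4(2)] yQ by (simp add: y_def)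
    qed
  qed
  obtain a b where "y = of_int a / of_int b" "b > 0"
    using Rats_cases'[OF assms(1)] by blast
  moreover from this have "0 \<le> a" "a \<le> b"
    using assms(2) by (auto simp: zero_le_divide_iff)
  ultimately show ?thesis using main[of a b] by simp
qed

lemma ex_ocf_represents:
  assumes "y \<in> \<rat>" "y \<in> {0..1}"
  shows "\<exists>ws. ocf_represents ws y"
  using assms
proof (induction rule: Rats_branch_induct)
  case zero
  then show ?case using ocf_represents_Nil by blast
next
  case (branch1 y)
  then show ?case using ocf_represents_branch1 by blast
next
  case (branch2 y)
  then show ?case using ocf_represents_branch2[of _ y] by auto
next
  case (branch3 y)
  then show ?case using ocf_represents_branch3[of _ y] by auto
qed

lemma ocf_cosum_0: "ocf_cosum 0 = 0"
  using ocf_represents_cosum[of "[]" 0] by (simp add: ocf_represents_Nil)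

lemma ocf_cosum_branch1:
  assumes "y \<in> \<rat>" "y \<in> {0..1}"
  shows "ocf_cosum (branch1 y) = ocf_cosum y + 1"
  using ex_ocf_represents[OF assms] ocf_represents_branch1 ocf_represents_cosum by metis

lemma ocf_cosum_branch2:
  assumes "y \<in> \<rat>" "y \<in> {0..<1}"
  shows "ocf_cosum (branch2 y) = ocf_cosum y + 3"
proof -
  have "y \<in> {0..1}" "y < 1" using assms by auto
  then show ?thesis
    using ex_ocf_represents[OF assms(1)] ocf_represents_branch2 ocf_represents_cosum by metis
qed

lemma ocf_cosum_branch3:
  assumes "y \<in> \<rat>" "y \<in> {0<..1}"
  shows "ocf_cosum (branch3 y) = ocf_cosum y + 2"
proof -
  have "y \<in> {0..1}" "0 < y" using assms by auto
  then show ?thesis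
    using ex_ocf_represents[OF assms(1)] ocf_represents_branch3 ocf_represents_cosum by metis
qed

section \<open>Counting rationals by digit sum\<close>

definition ocf_upto :: "nat \<Rightarrow> real set" where
  "ocf_upto m = {y \<in> \<rat> \<inter> {0..1}. ocf_cosum y \<le> m}"

text \<open>The inequality is strict because the points \<open>1 - y\<close> at most
  \<open>1 - x\<close> are those with \<open>y\<close> at least \<open>x\<close>, the complement of
  the set counted here.\<close>

definition ocf_count :: "nat \<Rightarrow> real \<Rightarrow> nat" where
  "ocf_count m x = card {y \<in> ocf_upto m. y < x}"

lemma branch1_in_upto: "y \<in> ocf_upto m \<Longrightarrow> branch1 y \<in> ocf_upto (m + 1)"
  using ocf_cosum_branch1[of y] branch_Rats(1)[of y]
  by (auto simp: ocf_upto_def branch1_def)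

lemma branch2_in_upto: "y \<in> ocf_upto m \<Longrightarrow> y < 1 \<Longrightarrow> branch2 y \<in> ocf_upto (m + 3)"
  using ocf_cosum_branch2[of y] branch_Rats(2)[of y]
  by (auto simp: ocf_upto_def branch2_def)

lemma branch3_in_upto:
  assumes "y \<in> ocf_upto m"
  shows "branch3 y \<in> ocf_upto (m + 2)"
proof (cases "y = 0")
  case True
  then show ?thesis by (simp add: branch3_def ocf_upto_def ocf_cosum_0)
next
  case False
  then show ?thesis
    using assms ocf_cosum_branch3[of y] branch_Rats(3)[of y]
    by (auto simp: ocf_upto_def branch3_def)
qed

text \<open>The inverse branch lowers the digit sum. The first conclusion says that \<open>m\<close>
  is positive, so \<open>m - 1\<close> is not truncated.\<close>

lemma ocf_upto_branch1E:
  assumes "z \<in> ocf_upto m" "1/2 \<le> z"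
  obtains y where "m = Suc (m - 1)" "y \<in> ocf_upto (m - 1)" "z = branch1 y"
proof -
  define y where "y = 1 / z - 1"
  have "z \<in> {1/2..1}" using assms by (auto simp: ocf_upto_def)
  note y = branch1_surj[OF this, folded y_def]
  have "y \<in> \<rat>" using assms(1) by (auto simp: ocf_upto_def y_def)
  then have "ocf_cosum y + 1 \<le> m"
    using ocf_cosum_branch1[of y] y assms(1) by (auto simp: ocf_upto_def)
  then show ?thesis using that[of y] y \<open>y \<in> \<rat>\<close> by (auto simp: ocf_upto_def)
qed

lemma ocf_upto_branch2E:
  assumes "z \<in> ocf_upto m" "1/3 \<le> z" "z < 1/2"
  obtains y where "m \<ge> 3" "y \<in> ocf_upto (m - 3)" "y < 1" "z = branch2 y"
proof -
  define y where "y = 3 - 1 / z"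
  have "z \<in> {1/3..<1/2}" using assms by (auto simp: ocf_upto_def)
  note y = branch2_surj[OF this, folded y_def]
  have "y \<in> \<rat>" using assms(1) by (auto simp: ocf_upto_def y_def)
  then have "ocf_cosum y + 3 \<le> m"
    using ocf_cosum_branch2[of y] y assms(1) by (auto simp: ocf_upto_def)
  then show ?thesis using that[of y] y \<open>y \<in> \<rat>\<close> by (auto simp: ocf_upto_def)
qed

lemma ocf_upto_branch3E:
  assumes "z \<in> ocf_upto m" "z \<le> 1/3" "z \<noteq> 0"
  obtains y where "m \<ge> 2" "y \<in> ocf_upto (m - 2)" "z = branch3 y"
proof -
  define y where "y = z / (1 - 2 * z)"
  have "z \<in> {0<..1/3}" using assms by (auto simp: ocf_upto_def)
  note y = branch3_surj[OF this, folded y_def]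
  have "y \<in> \<rat>" using assms(1) by (auto simp: ocf_upto_def y_def)
  then have "ocf_cosum y + 2 \<le> m"
    using ocf_cosum_branch3[of y] y assms(1) by (auto simp: ocf_upto_def)
  then show ?thesis using that[of y] y \<open>y \<in> \<rat>\<close> by (auto simp: ocf_upto_def)
qed

lemma zero_in_ocf_upto: "0 \<in> ocf_upto m"
  by (simp add: ocf_upto_def ocf_cosum_0)

lemma one_in_ocf_upto: "1 \<in> ocf_upto (Suc m)"
  using branch1_in_upto[OF zero_in_ocf_upto, of m] by (simp add: branch1_def)

text \<open>Every nonzero point is a branch image of a point of a strictly lower level.\<close>

lemma finite_ocf_upto: "finite (ocf_upto m)"
proof (induction m rule: less_induct)
  case (less m)
  have "ocf_upto m \<subseteq> insert 0 (\<Union>k<m. branch1 ` ocf_upto k \<union> branch2 ` ocf_upto k \<union> branch3 ` ocf_upto k)"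
    (is "_ \<subseteq> ?R")
  proof
    fix z assume z: "z \<in> ocf_upto m"
    consider "1/2 \<le> z" | "1/3 \<le> z" "z < 1/2" | "z \<le> 1/3" "z \<noteq> 0" | "z = 0" by linarith
    then show "z \<in> ?R"
    proof cases
      case 1
      then obtain y where "m = Suc (m - 1)" "y \<in> ocf_upto (m - 1)" "z = branch1 y"
        by (rule ocf_upto_branch1E[OF z])
      then show ?thesis by (intro insertI2 UN_I[of "m - 1"]) auto
    next
      case 2
      then obtain y where "m \<ge> 3" "y \<in> ocf_upto (m - 3)" "z = branch2 y"
        by (rule ocf_upto_branch2E[OF z])
      then show ?thesis by (intro insertI2 UN_I[of "m - 3"]) auto
    next
      case 3
      then obtain y where "m \<ge> 2" "y \<in> ocf_upto (m - 2)" "z = branch3 y"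
        by (rule ocf_upto_branch3E[OF z])
      then show ?thesis by (intro insertI2 UN_I[of "m - 2"]) auto
    qed simp
  qed
  moreover have "finite ?R" using less by auto
  ultimately show ?case by (rule finite_subset)
qed

section \<open>Counts along the branches and the tribonacci recurrence\<close>

lemma branch1_le_iff: "0 \<le> x \<Longrightarrow> 0 \<le> y \<Longrightarrow> branch1 x \<le> branch1 y \<longleftrightarrow> y \<le> x"
  by (simp add: branch1_def field_simps)

lemma branch2_less_iff: "x \<le> 1 \<Longrightarrow> y \<le> 1 \<Longrightarrow> branch2 x < branch2 y \<longleftrightarrow> x < y"
  by (simp add: branch2_def field_simps)

lemma branch3_less_iff: "0 \<le> x \<Longrightarrow> 0 \<le> y \<Longrightarrow> branch3 x < branch3 y \<longleftrightarrow> x < y"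
  by (simp add: branch3_def field_simps)

lemma ocf_count_branch3:
  assumes "x \<in> {0..1}"
  shows "ocf_count (m + 2) (branch3 x) = ocf_count m x"
proof -
  have "{z \<in> ocf_upto (m + 2). z < branch3 x} = branch3 ` {y \<in> ocf_upto m. y < x}"
  proof (intro equalityI subsetI)
    fix z assume z: "z \<in> {z \<in> ocf_upto (m + 2). z < branch3 x}"
    have "branch3 x \<le> 1/3" using assms by (simp add: branch3_def field_simps)
    then have le: "z \<le> 1/3" using z by simp
    show "z \<in> branch3 ` {y \<in> ocf_upto m. y < x}"
    \<comment> \<open>The point 0 is its own image under \<open>branch3\<close> and has digit sum 0
      at every level, so it falls outside the digit-sum shift and is matched with itself.\<close>
    proof (cases "z = 0")
      case True
      then have "0 < x" using z assms by (cases "x = 0") (auto simp: branch3_def)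
      then show ?thesis
        using True zero_in_ocf_upto by (intro image_eqI[of _ _ 0]) (auto simp: branch3_def)
    next
      case False
      then obtain y where "y \<in> ocf_upto (m + 2 - 2)" "z = branch3 y"
        using ocf_upto_branch3E[OF _ le] z by blast
      moreover from this have "y < x"
        using z assms branch3_less_iff[of y x] by (auto simp: ocf_upto_def)
      ultimately show ?thesis by auto
    qed
  next
    fix z assume "z \<in> branch3 ` {y \<in> ocf_upto m. y < x}"
    then show "z \<in> {z \<in> ocf_upto (m + 2). z < branch3 x}"
      using assms branch3_in_upto branch3_less_iff[of _ x] by (auto simp: ocf_upto_def)
  qed
  moreover have "inj_on branch3 {y \<in> ocf_upto m. y < x}"
  proof (rule inj_onI)
    fix a b
    assume "a \<in> {y \<in> ocf_upto m. y < x}" "b \<in> {y \<in> ocf_upto m. y < x}"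
      and eq: "branch3 a = branch3 b"
    then have "0 \<le> a" "0 \<le> b" by (auto simp: ocf_upto_def)
    then show "a = b"
      using branch3_less_iff[of a b] branch3_less_iff[of b a] eq by linarith
  qed
  ultimately show ?thesis by (simp add: ocf_count_def card_image)
qed

text \<open>As \<open>branch1\<close> reverses order, points up to \<open>x\<close> correspond to
  points from \<open>branch1 x\<close> upwards. The count below \<open>branch1 x\<close> is
  therefore a complement, and a non-strict inequality appears.\<close>

lemma ocf_count_branch1:
  assumes "x \<in> {0..1}"
  shows "card (ocf_upto (m + 1)) =
    ocf_count (m + 1) (branch1 x) + card {y \<in> ocf_upto m. y \<le> x}"
proof -
  have "{z \<in> ocf_upto (m + 1). branch1 x \<le> z} = branch1 ` {y \<in> ocf_upto m. y \<le> x}"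
  proof (intro equalityI subsetI)
    fix z assume z: "z \<in> {z \<in> ocf_upto (m + 1). branch1 x \<le> z}"
    have "1/2 \<le> branch1 x" using assms by (simp add: branch1_def field_simps)
    then have "1/2 \<le> z" using z by simp
    then obtain y where "y \<in> ocf_upto (m + 1 - 1)" "z = branch1 y"
      using ocf_upto_branch1E[of z "m + 1"] z by blast
    moreover from this have "y \<le> x"
      using z assms branch1_le_iff[of x y] by (auto simp: ocf_upto_def)
    ultimately show "z \<in> branch1 ` {y \<in> ocf_upto m. y \<le> x}" by auto
  next
    fix z assume "z \<in> branch1 ` {y \<in> ocf_upto m. y \<le> x}"
    then show "z \<in> {z \<in> ocf_upto (m + 1). branch1 x \<le> z}"
      using assms branch1_in_upto branch1_le_iff[of x] by (auto simp: ocf_upto_def)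
  qed
  moreover have "inj_on branch1 {y \<in> ocf_upto m. y \<le> x}"
    by (auto simp: inj_on_def branch1_def)
  ultimately have "card {z \<in> ocf_upto (m + 1). branch1 x \<le> z} = card {y \<in> ocf_upto m. y \<le> x}"
    by (simp add: card_image)
  moreover have "ocf_upto (m + 1) =
      {z \<in> ocf_upto (m + 1). z < branch1 x} \<union> {z \<in> ocf_upto (m + 1). branch1 x \<le> z}"
    by auto
  then have "card (ocf_upto (m + 1)) =
      ocf_count (m + 1) (branch1 x) + card {z \<in> ocf_upto (m + 1). branch1 x \<le> z}"
    unfolding ocf_count_def
    by (subst card_Un_disjoint[symmetric]) (auto simp: finite_ocf_upto)
  ultimately show ?thesis by simp
qed

text \<open>The points below \<open>branch2 x\<close> split at 1/3, which is
  \<open>branch3 1\<close>: the lower ones are counted by \<open>ocf_count_branch3\<close>, the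
  others are images under \<open>branch2\<close>.\<close>

lemma ocf_count_branch2:
  assumes "x \<in> {0..1}"
  shows "ocf_count (m + 3) (branch2 x) = ocf_count (m + 1) 1 + ocf_count m x"
proof -
  have third: "1/3 \<le> branch2 y" if "0 \<le> y" "y \<le> 1" for y
    using that by (simp add: branch2_def field_simps)
  have "{z \<in> ocf_upto (m + 3). z < branch2 x} =
    {z \<in> ocf_upto (m + 3). z < 1/3} \<union> branch2 ` {y \<in> ocf_upto m. y < x}"
  proof (intro equalityI subsetI)
    fix z assume z: "z \<in> {z \<in> ocf_upto (m + 3). z < branch2 x}"
    show "z \<in> {z \<in> ocf_upto (m + 3). z < 1/3} \<union> branch2 ` {y \<in> ocf_upto m. y < x}"
    proof (cases "z < 1/3")
      case False
      have "branch2 x \<le> 1/2" using assms by (simp add: branch2_def field_simps)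
      then have "z < 1/2" using z by simp
      moreover have "1/3 \<le> z" "z \<in> ocf_upto (m + 3)" using z False by auto
      ultimately obtain y where "y \<in> ocf_upto (m + 3 - 3)" "z = branch2 y"
        using ocf_upto_branch2E by blast
      moreover from this have "y < x"
        using z assms branch2_less_iff[of y x] by (auto simp: ocf_upto_def)
      ultimately show ?thesis by auto
    qed (use z in auto)
  next
    fix z
    assume "z \<in> {z \<in> ocf_upto (m + 3). z < 1/3} \<union> branch2 ` {y \<in> ocf_upto m. y < x}"
    then show "z \<in> {z \<in> ocf_upto (m + 3). z < branch2 x}"
    proof
      assume "z \<in> {z \<in> ocf_upto (m + 3). z < 1/3}"
      then show ?thesis using third[of x] assms by auto
    next
      assume "z \<in> branch2 ` {y \<in> ocf_upto m. y < x}"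
      then obtain y where "y \<in> ocf_upto m" "y < x" "z = branch2 y" by auto
      then show ?thesis
        using assms branch2_in_upto[of y m] branch2_less_iff[of y x] by auto
    qed
  qed
  moreover have "{z \<in> ocf_upto (m + 3). z < 1/3} \<inter> branch2 ` {y \<in> ocf_upto m. y < x} = {}"
    using third by (force simp: ocf_upto_def)
  moreover have "inj_on branch2 {y \<in> ocf_upto m. y < x}"
    by (auto simp: inj_on_def branch2_def)
  moreover have "ocf_count (m + 3) (1/3) = ocf_count (m + 1) 1"
    using ocf_count_branch3[of 1 "m + 1"] by (simp add: branch3_def numeral_3_eq_3)
  ultimately show ?thesis
    by (simp add: ocf_count_def card_image card_Un_disjoint finite_ocf_upto)
qed

lemma card_ocf_upto_Suc: "card (ocf_upto (Suc m)) = ocf_count (Suc m) 1 + 1"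
proof -
  have "ocf_upto (Suc m) = insert 1 {y \<in> ocf_upto (Suc m). y < 1}"
    using one_in_ocf_upto by (auto simp: ocf_upto_def)
  then have "card (ocf_upto (Suc m)) = card (insert 1 {y \<in> ocf_upto (Suc m). y < 1})"
    by (rule arg_cong)
  then show ?thesis
    by (simp add: ocf_count_def finite_ocf_upto)
qed

text \<open>Split at 1/2, which is both \<open>branch1 1\<close> and \<open>branch2 1\<close>. The
  endpoint 1 adds one to the cardinality on either side and cancels.\<close>

lemma ocf_count_tribonacci:
  "ocf_count (m + 4) 1 = ocf_count (m + 3) 1 + ocf_count (m + 2) 1 + ocf_count (m + 1) 1"
proof -
  have "{y \<in> ocf_upto (m + 3). y \<le> 1} = ocf_upto (m + 3)"
    by (auto simp: ocf_upto_def)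
  then have "card (ocf_upto (m + 4)) = ocf_count (m + 4) (1/2) + card (ocf_upto (m + 3))"
    using ocf_count_branch1[of 1 "m + 3"] by (simp add: branch1_def add.commute)
  moreover have "ocf_count (m + 4) (1/2) = ocf_count (m + 2) 1 + ocf_count (m + 1) 1"
    using ocf_count_branch2[of 1 "m + 1"] by (simp add: branch2_def add.commute)
  ultimately show ?thesis
    using card_ocf_upto_Suc[of "m + 3"] card_ocf_upto_Suc[of "m + 2"] by (simp add: eval_nat_numeral)
qed

text \<open>Strict and non-strict counts differ by at most one point, an error that vanishes after
  rescaling.\<close>

lemma card_upto_atMost_count:
  obtains d where "d \<in> {0, 1::nat}" "card {y \<in> ocf_upto m. y \<le> x} = ocf_count m x + d"
proof (cases "x \<in> ocf_upto m")
  case True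
  then have "{y \<in> ocf_upto m. y \<le> x} = insert x {y \<in> ocf_upto m. y < x}" by auto
  then have "card {y \<in> ocf_upto m. y \<le> x} = ocf_count m x + 1"
    by (simp add: ocf_count_def finite_ocf_upto)
  then show ?thesis using that by blast
next
  case False
  then have "{y \<in> ocf_upto m. y \<le> x} = {y \<in> ocf_upto m. y < x}"
    by (metis (lifting) less_le)
  then show ?thesis using that[of 0] by (simp add: ocf_count_def)
qed

text \<open>The reflection \<open>1 - y\<close> maps \<open>ocf_upto (n + 1)\<close> bijectively
  onto \<open>ocf_set n\<close> and reverses the order.\<close>

lemma ocf_dist_approx_count:
  "ocf_dist_approx n (1 - x) =
     1 - real (ocf_count (n + 1) x) / real (card (ocf_upto (n + 1)))"
proof -
  let ?r = "\<lambda>y::real. 1 - y"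
  have inj: "inj_on ?r S" for S by (auto simp: inj_on_def)
  have sub: "1 - y \<in> \<rat> \<longleftrightarrow> y \<in> \<rat>" for y :: real
    by (metis Rats_1 Rats_diff diff_diff_eq2 add_diff_cancel_left')
  have set: "ocf_set n = ?r ` ocf_upto (n + 1)"
  proof (intro equalityI subsetI)
    fix z assume "z \<in> ocf_set n"
    then have "1 - z \<in> ocf_upto (n + 1)"
      by (auto simp: ocf_set_def ocf_upto_def ocf_cosum_def sub)
    then show "z \<in> ?r ` ocf_upto (n + 1)" by (rule image_eqI[rotated]) simp
  qed (auto simp: ocf_set_def ocf_upto_def ocf_cosum_def)
  have "{\<xi> \<in> ocf_set n. \<xi> \<le> 1 - x} = ?r ` (ocf_upto (n + 1) - {y \<in> ocf_upto (n + 1). y < x})"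
    unfolding set by auto
  then have "card {\<xi> \<in> ocf_set n. \<xi> \<le> 1 - x} =
      card (ocf_upto (n + 1) - {y \<in> ocf_upto (n + 1). y < x})"
    by (simp add: card_image[OF inj])
  also have "\<dots> = card (ocf_upto (n + 1)) - ocf_count (n + 1) x"
    unfolding ocf_count_def by (rule card_Diff_subset) (auto simp: finite_ocf_upto)
  moreover have "ocf_count (n + 1) x \<le> card (ocf_upto (n + 1))"
    unfolding ocf_count_def by (rule card_mono) (auto simp: finite_ocf_upto)
  moreover have "card (ocf_upto (n + 1)) > 0"
    using zero_in_ocf_upto finite_ocf_upto card_gt_0_iff by blast
  moreover have "card (ocf_set n) = card (ocf_upto (n + 1))"
    by (simp add: set card_image[OF inj])
  ultimately show ?thesis
    by (simp add: ocf_dist_approx_def of_nat_diff diff_divide_distrib)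
qed

section \<open>Convergence of the rescaled counts\<close>

lemma second_order_contraction_tendsto_0:
  fixes e :: "nat \<Rightarrow> real"
  assumes rec: "\<And>m. \<bar>e (m + 2)\<bar> \<le> \<alpha> * \<bar>e (m + 1)\<bar> + \<beta> * \<bar>e m\<bar>"
    and "0 \<le> \<alpha>" "0 \<le> \<beta>" "\<alpha> + \<beta> < 1"
  shows "e \<longlonglongrightarrow> 0"
proof -
  \<comment> \<open>The weight \<open>s\<close> is chosen so that \<open>V\<close> below contracts
    by \<open>r\<close>, the midpoint between \<open>\<alpha> + \<beta>\<close> and 1. This needs
    \<open>\<alpha> + s = r\<close> and \<open>\<beta> \<le> r * s\<close>; the product shown
    nonnegative below is four times \<open>r * s - \<beta>\<close>.\<close>
  define s r where "s = (1 - \<alpha> + \<beta>) / 2" and "r = (1 + \<alpha> + \<beta>) / 2"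
  have s: "0 < s" and r: "0 \<le> r" "r < 1" "\<alpha> + s = r"
    using assms(2-4) by (auto simp: s_def r_def field_simps)
  have "0 \<le> (1 - \<beta> - \<alpha>) * (1 - \<beta> + \<alpha>)"
    using assms(2-4) by (intro mult_nonneg_nonneg) auto
  then have \<beta>: "\<beta> \<le> r * s" by (simp add: s_def r_def field_simps)
  define V where "V m = \<bar>e (m + 1)\<bar> + s * \<bar>e m\<bar>" for m
  have "V (Suc m) \<le> r * V m" for m
  proof -
    have "V (Suc m) \<le> (\<alpha> + s) * \<bar>e (m + 1)\<bar> + \<beta> * \<bar>e m\<bar>"
      using rec[of m] by (simp add: V_def algebra_simps)
    also have "\<dots> \<le> r * \<bar>e (m + 1)\<bar> + (r * s) * \<bar>e m\<bar>"
      using \<beta> by (intro add_mono mult_right_mono) (auto simp: r)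
    finally show ?thesis by (simp add: V_def algebra_simps)
  qed
  then have "V m \<le> V 0 * r ^ m" for m
  proof (induction m)
    case (Suc m)
    have "V (Suc m) \<le> r * V m" by (fact Suc.prems)
    also have "\<dots> \<le> r * (V 0 * r ^ m)" using Suc r by (intro mult_left_mono) auto
    finally show ?case by (simp add: mult_ac)
  qed simp
  moreover have "\<bar>e (Suc m)\<bar> \<le> V m" for m using s by (simp add: V_def)
  ultimately have "\<bar>e (Suc m)\<bar> \<le> V 0 * r ^ m" for m by (meson order_trans)
  then have "\<forall>\<^sub>F m in sequentially. norm (e (Suc m)) \<le> V 0 * r ^ m" by simp
  moreover have "(\<lambda>m. V 0 * r ^ m) \<longlonglongrightarrow> 0"
    using r by (intro tendsto_mult_right_zero LIMSEQ_power_zero) auto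
  ultimately have "(\<lambda>m. e (Suc m)) \<longlonglongrightarrow> 0"
    by (rule Lim_null_comparison)
  then show ?thesis by (rule LIMSEQ_imp_Suc)
qed

text \<open>Says that limsup minus liminf of \<open>u\<close> is at most \<open>b\<close>; the slack
  \<epsilon> makes the bound purely asymptotic.\<close>

definition oscillates_within :: "real \<Rightarrow> (nat \<Rightarrow> real) \<Rightarrow> bool" where
  "oscillates_within b u \<longleftrightarrow> (\<forall>\<epsilon>>0. \<exists>M. \<forall>m\<ge>M. \<forall>n\<ge>M. \<bar>u m - u n\<bar> < b + \<epsilon>)"

text \<open>A convergent summand and an index shift do not affect the asymptotic oscillation, so
  only the factor \<open>r\<close> counts.\<close>

lemma oscillates_within_affine:
  assumes "convergent u" "oscillates_within b w" "\<And>m. v (m + k) = u m + r * w m"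
  shows "oscillates_within (\<bar>r\<bar> * b) v"
  unfolding oscillates_within_def
proof (intro allI impI)
  fix \<epsilon> :: real assume "\<epsilon> > 0"
  \<comment> \<open>Adding 1 in the denominator covers the case \<open>r = 0\<close>.\<close>
  define \<delta> where "\<delta> = \<epsilon> / (2 * (\<bar>r\<bar> + 1))"
  have \<delta>: "\<delta> > 0" "\<bar>r\<bar> * \<delta> \<le> \<epsilon> / 2" using \<open>\<epsilon> > 0\<close> by (auto simp: \<delta>_def field_simps)
  obtain M where M: "\<And>m n. m \<ge> M \<Longrightarrow> n \<ge> M \<Longrightarrow> \<bar>w m - w n\<bar> < b + \<delta>"
    using assms(2) \<delta> unfolding oscillates_within_def by meson
  have "Cauchy u" using assms(1) by (rule convergent_Cauchy)
  then obtain N where N: "\<And>m n. m \<ge> N \<Longrightarrow> n \<ge> N \<Longrightarrow> \<bar>u m - u n\<bar> < \<epsilon> / 2"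
    using \<open>\<epsilon> > 0\<close> unfolding Cauchy_def dist_real_def by (meson half_gt_zero)
  have "\<bar>v m - v n\<bar> < \<bar>r\<bar> * b + \<epsilon>" if "m \<ge> M + N + k" "n \<ge> M + N + k" for m n
  proof -
    define i j where "i = m - k" and "j = n - k"
    then have ij: "m = i + k" "n = j + k" "i \<ge> M + N" "j \<ge> M + N"
      using that by auto
    have "v m - v n = (u i - u j) + r * (w i - w j)"
      by (simp add: ij assms(3) algebra_simps)
    then have "\<bar>v m - v n\<bar> \<le> \<bar>u i - u j\<bar> + \<bar>r\<bar> * \<bar>w i - w j\<bar>"
      by (metis abs_mult abs_triangle_ineq)
    also have "\<dots> < \<epsilon> / 2 + \<bar>r\<bar> * (b + \<delta>)"
      using N[of i j] M[of i j] ij by (intro add_less_le_mono mult_left_mono) auto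
    also have "\<dots> \<le> \<bar>r\<bar> * b + \<epsilon>" using \<delta>(2) by (simp add: algebra_simps)
    finally show ?thesis .
  qed
  then show "\<exists>M. \<forall>m\<ge>M. \<forall>n\<ge>M. \<bar>v m - v n\<bar> < \<bar>r\<bar> * b + \<epsilon>" by blast
qed

lemma oscillates_within_mono: "oscillates_within b u \<Longrightarrow> b \<le> c \<Longrightarrow> oscillates_within c u"
  unfolding oscillates_within_def by (metis (no_types) add_right_mono order_less_le_trans)

lemma convergent_if_oscillates_within:
  fixes u :: "nat \<Rightarrow> real"
  assumes "\<And>k. oscillates_within (b k) u" "b \<longlonglongrightarrow> 0"
  shows "convergent u"
proof -
  have "Cauchy u"
    unfolding Cauchy_def dist_real_def
  proof (intro allI impI)
    fix \<epsilon> :: real assume "\<epsilon> > 0"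
    then obtain k where "b k < \<epsilon> / 2"
      using order_tendstoD(2)[OF assms(2), of "\<epsilon> / 2"] by (auto simp: eventually_sequentially)
    moreover obtain M where "\<forall>m\<ge>M. \<forall>n\<ge>M. \<bar>u m - u n\<bar> < b k + \<epsilon> / 2"
      using assms(1)[of k] \<open>\<epsilon> > 0\<close> half_gt_zero unfolding oscillates_within_def by blast
    ultimately show "\<exists>M. \<forall>m\<ge>M. \<forall>n\<ge>M. \<bar>u m - u n\<bar> < \<epsilon>"
      by (smt (verit) field_sum_of_halves)
  qed
  then show ?thesis by (rule Cauchy_convergent)
qed

section \<open>Rescaling by powers of \<open>p\<close>, the reciprocal of the tribonacci
  constant\<close>

locale tribonacci_ratio =
  fixes p :: real
  assumes p_pos: "0 < p" and p_eq: "p + p ^ 2 + p ^ 3 = 1"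
begin

lemma p_less_1: "p < 1"
proof -
  have "0 < p ^ 2" "0 < p ^ 3" using p_pos by auto
  then show ?thesis using p_eq by linarith
qed

lemma tribonacci_tendsto:
  fixes t :: "nat \<Rightarrow> real"
  assumes rec: "\<And>m. t (m + 3) = p * t (m + 2) + p ^ 2 * t (m + 1) + p ^ 3 * t m"
    and pos: "\<And>m. 0 < t m"
  obtains c where "0 < c" "t \<longlonglongrightarrow> c"
proof -
  \<comment> \<open>\<open>J\<close> comes from dividing the characteristic polynomial of the recurrence by its root \<open>1\<close>;
    it is constant, so the distance of \<open>t\<close> to the limit obeys a contracting second-order recurrence.\<close>
  define J where "J m = t (m + 2) + (p ^ 2 + p ^ 3) * t (m + 1) + p ^ 3 * t m" for m
  have "J (Suc m) = J m" for m
  proof -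
    have "J (Suc m) = t (m + 3) + (p ^ 2 + p ^ 3) * t (m + 2) + p ^ 3 * t (m + 1)"
      by (simp add: J_def eval_nat_numeral)
    also have "\<dots> = (p + p ^ 2 + p ^ 3) * t (m + 2) + (p ^ 2 + p ^ 3) * t (m + 1) + p ^ 3 * t m"
      by (simp add: rec algebra_simps)
    finally show ?thesis by (simp add: p_eq J_def)
  qed
  then have J: "J m = J 0" for m by (induction m) auto
  \<comment> \<open>\<open>D\<close> is the value of the invariant on the constant sequence 1, so
    \<open>J 0 / D\<close> is the only possible limit.\<close>
  define D where "D = 1 + p ^ 2 + 2 * p ^ 3"
  have D: "D > 0" using p_pos by (simp add: D_def add_pos_nonneg)
  define c where "c = J 0 / D"
  have "J 0 > 0" unfolding J_def using pos p_pos
    by (intro add_pos_nonneg mult_nonneg_nonneg add_nonneg_nonneg) (auto intro: less_imp_le)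
  then have "c > 0" using D by (simp add: c_def)
  have "(\<lambda>m. t m - c) \<longlonglongrightarrow> 0"
  proof (rule second_order_contraction_tendsto_0)
    fix m
    have "c * D = J m" using D J[of m] by (simp add: c_def)
    then have "t (m + 2) - c = - (p ^ 2 + p ^ 3) * (t (m + 1) - c) - p ^ 3 * (t m - c)"
      unfolding J_def D_def by (simp add: algebra_simps)
    then have "\<bar>t (m + 2) - c\<bar> \<le> \<bar>(p ^ 2 + p ^ 3) * (t (m + 1) - c)\<bar> + \<bar>p ^ 3 * (t m - c)\<bar>"
      by linarith
    moreover have "\<bar>p ^ 2 + p ^ 3\<bar> = p ^ 2 + p ^ 3" "\<bar>p ^ 3\<bar> = p ^ 3" using p_pos by auto
    ultimately show "\<bar>t (m + 2) - c\<bar> \<le> (p ^ 2 + p ^ 3) * \<bar>t (m + 1) - c\<bar> + p ^ 3 * \<bar>t m - c\<bar>"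
      by (simp only: abs_mult)
  next
    have "p ^ 3 < p ^ 1" using p_pos p_less_1 by (intro power_strict_decreasing) auto
    then show "p ^ 2 + p ^ 3 + p ^ 3 < 1" using p_eq by simp
  qed (use p_pos in auto)
  then have "t \<longlonglongrightarrow> c" by (simp add: LIM_zero_iff)
  then show ?thesis using that \<open>c > 0\<close> by blast
qed

lemma power_tendsto_0: "(\<lambda>m. p ^ m) \<longlonglongrightarrow> 0"
  using p_pos p_less_1 by (intro LIMSEQ_power_zero) auto

definition mass :: "nat \<Rightarrow> real \<Rightarrow> real" where
  "mass m x = real (ocf_count m x) * p ^ m"

definition total_mass :: "nat \<Rightarrow> real" where
  "total_mass m = real (card (ocf_upto m)) * p ^ m"

lemma mass_1_tendsto:
  obtains c where "0 < c" "(\<lambda>m. mass m 1) \<longlonglongrightarrow> c"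
proof -
  have "0 < ocf_count (Suc m) 1" for m
    unfolding ocf_count_def using zero_in_ocf_upto finite_ocf_upto
    by (auto simp: card_gt_0_iff intro!: exI[of _ 0])
  then have pos: "0 < mass (Suc m) 1" for m using p_pos by (simp add: mass_def)
  have "mass (Suc (m + 3)) 1 =
      p * mass (Suc (m + 2)) 1 + p ^ 2 * mass (Suc (m + 1)) 1 + p ^ 3 * mass (Suc m) 1" for m
    using ocf_count_tribonacci[of m] by (simp add: mass_def algebra_simps eval_nat_numeral)
  from tribonacci_tendsto[OF this pos]
  obtain c where "0 < c" "(\<lambda>m. mass (Suc m) 1) \<longlonglongrightarrow> c" by blast
  then show ?thesis by (intro that[of c]) (simp_all add: filterlim_sequentially_Suc[of "\<lambda>m. mass m 1"])
qed

definition limit_total :: real where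
  "limit_total = lim (\<lambda>m. mass m 1)"

lemma limit_total: "0 < limit_total" "(\<lambda>m. mass m 1) \<longlonglongrightarrow> limit_total"
proof -
  obtain d where d: "0 < d" "(\<lambda>m. mass m 1) \<longlonglongrightarrow> d" using mass_1_tendsto .
  moreover have "limit_total = d"
    unfolding limit_total_def by (rule limI) (rule d(2))
  ultimately show "0 < limit_total" "(\<lambda>m. mass m 1) \<longlonglongrightarrow> limit_total" by auto
qed

text \<open>The total differs from \<open>mass m 1\<close> only by the endpoint 1, whose weight
  \<open>p ^ m\<close> tends to 0.\<close>

lemma total_mass_tendsto: "total_mass \<longlonglongrightarrow> limit_total"
proof -
  have "total_mass (Suc m) = mass (Suc m) 1 + p ^ Suc m" for m
    by (simp add: total_mass_def mass_def card_ocf_upto_Suc algebra_simps)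
  moreover have "(\<lambda>m. mass (Suc m) 1 + p ^ Suc m) \<longlonglongrightarrow> limit_total + 0"
    using limit_total(2) power_tendsto_0 by (intro tendsto_add LIMSEQ_Suc)
  ultimately show ?thesis by (simp add: filterlim_sequentially_Suc[of total_mass, symmetric])
qed

lemma mass_branch3:
  assumes "x \<in> {0..1}"
  shows "mass (m + 2) (branch3 x) = p ^ 2 * mass m x"
  unfolding mass_def ocf_count_branch3[OF assms] by (simp only: power_add mult_ac)

lemma mass_branch2:
  assumes "x \<in> {0..1}"
  shows "mass (m + 3) (branch2 x) = p ^ 2 * mass (m + 1) 1 + p ^ 3 * mass m x"
proof -
  have "p ^ (m + 3) = p ^ 2 * p ^ (m + 1)" by (simp add: eval_nat_numeral)
  moreover have "p ^ (m + 3) = p ^ 3 * p ^ m" by (simp only: power_add mult_ac)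
  ultimately show ?thesis
    unfolding mass_def ocf_count_branch2[OF assms] of_nat_add distrib_right by simp
qed

text \<open>The sequence \<open>u\<close> is the total mass up to the possible contribution of the
  single point \<open>x\<close>, which has weight at most \<open>p ^ (m + 1)\<close>.\<close>

lemma mass_branch1:
  assumes "x \<in> {0..1}"
  obtains u where "u \<longlonglongrightarrow> limit_total" "\<And>m. mass (m + 1) (branch1 x) = u m - p * mass m x"
proof
  define u where "u m = mass (m + 1) (branch1 x) + p * mass m x" for m
  show "mass (m + 1) (branch1 x) = u m - p * mass m x" for m by (simp add: u_def)
  have "\<bar>u m - total_mass (Suc m)\<bar> \<le> p ^ Suc m" for m
  proof -
    obtain d where d: "d \<in> {0, 1::nat}" "card {y \<in> ocf_upto m. y \<le> x} = ocf_count m x + d"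
      by (rule card_upto_atMost_count)
    have "total_mass (Suc m) = u m + real d * p ^ Suc m"
      using ocf_count_branch1[OF assms, of m]
      by (simp add: total_mass_def u_def mass_def d(2) algebra_simps)
    then show ?thesis using d(1) p_pos by auto
  qed
  then have "\<forall>\<^sub>F m in sequentially. norm (u m - total_mass (Suc m)) \<le> p ^ Suc m" by simp
  moreover have "(\<lambda>m. p ^ Suc m) \<longlonglongrightarrow> 0" using power_tendsto_0 by (rule LIMSEQ_Suc)
  ultimately have "(\<lambda>m. u m - total_mass (Suc m)) \<longlonglongrightarrow> 0"
    by (rule Lim_null_comparison)
  from tendsto_add[OF this LIMSEQ_Suc[OF total_mass_tendsto]]
  show "u \<longlonglongrightarrow> limit_total" by (simp only: diff_add_cancel add_0)
qed

lemma mass_nonneg: "0 \<le> mass m x"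
  using p_pos by (simp add: mass_def)

lemma mass_le_total: "mass m x \<le> total_mass m"
proof -
  have "ocf_count m x \<le> card (ocf_upto m)"
    unfolding ocf_count_def by (rule card_mono) (auto simp: finite_ocf_upto)
  then show ?thesis using p_pos by (simp add: mass_def total_mass_def)
qed

text \<open>Each passage to a preimage of \<open>x\<close> multiplies the oscillation by
  \<open>p\<close>, \<open>p ^ 2\<close> or \<open>p ^ 3\<close>, hence by at most \<open>p\<close>.
  At \<open>x = 0\<close> all masses vanish and no preimage is taken.\<close>

lemma mass_oscillation:
  assumes B: "\<And>m. total_mass m \<le> B"
  shows "x \<in> {0..1} \<Longrightarrow> oscillates_within (p ^ k * B) (\<lambda>m. mass m x)"
proof (induction k arbitrary: x)
  case 0
  have "\<bar>mass m x - mass n x\<bar> \<le> B" for m n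
    using mass_nonneg[of m x] mass_nonneg[of n x] mass_le_total[of m x] mass_le_total[of n x]
      B[of m] B[of n] by linarith
  then have "\<bar>mass m x - mass n x\<bar> < B + \<epsilon>" if "\<epsilon> > 0" for m n \<epsilon>
    using that by (metis add_le_less_mono add_0_right)
  then show ?case by (simp add: oscillates_within_def)
next
  case (Suc k)
  have "0 \<le> B" using B[of 0] mass_nonneg[of 0 0] mass_le_total[of 0 0] by linarith
  then have shrink: "r * (p ^ k * B) \<le> p ^ Suc k * B" if "r \<le> p" for r
    using that p_pos by (simp add: mult.assoc[symmetric] mult_right_mono)
  have p_powers: "p ^ 2 \<le> p" "p ^ 3 \<le> p"
    using p_pos p_less_1 power_decreasing[of 1 2 p] power_decreasing[of 1 3 p] by auto
  consider "x \<in> {1/2..1}" | "x \<in> {1/3..<1/2}" | "x \<in> {0<..1/3}" | "x = 0"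
    using Suc.prems by force
  then show ?case
  proof cases
    case 1
    define z where "z = 1 / x - 1"
    note z = branch1_surj[OF 1, folded z_def]
    obtain u where u: "u \<longlonglongrightarrow> limit_total" "\<And>m. mass (m + 1) x = u m - p * mass m z"
      using mass_branch1[OF z(1)] z(2) by metis
    have "oscillates_within (\<bar>- p\<bar> * (p ^ k * B)) (\<lambda>m. mass m x)"
      using u by (intro oscillates_within_affine[OF _ Suc.IH[OF z(1)], of u _ 1])
        (auto simp: convergent_def)
    then show ?thesis using p_pos by (simp add: mult.assoc)
  next
    case 2
    define z where "z = 3 - 1 / x"
    note z = branch2_surj[OF 2, folded z_def]
    have zi: "z \<in> {0..1}" using z(1) by auto
    have "oscillates_within (\<bar>p ^ 3\<bar> * (p ^ k * B)) (\<lambda>m. mass m x)"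
    proof (rule oscillates_within_affine[OF _ Suc.IH[OF zi]])
      have "(\<lambda>m. p ^ 2 * mass (m + 1) 1) \<longlonglongrightarrow> p ^ 2 * limit_total"
        using LIMSEQ_Suc[OF limit_total(2)] by (intro tendsto_mult_left) simp
      then show "convergent (\<lambda>m. p ^ 2 * mass (m + 1) 1)" by (auto simp: convergent_def)
      show "mass (m + 3) x = p ^ 2 * mass (m + 1) 1 + p ^ 3 * mass m z" for m
        using mass_branch2[OF zi, of m] z(2) by simp
    qed
    then show ?thesis
      using p_pos oscillates_within_mono[OF _ shrink[OF p_powers(2)]] by simp
  next
    case 3
    define z where "z = x / (1 - 2 * x)"
    note z = branch3_surj[OF 3, folded z_def]
    have zi: "z \<in> {0..1}" using z(1) by auto
    have "oscillates_within (\<bar>p ^ 2\<bar> * (p ^ k * B)) (\<lambda>m. mass m x)"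
      using mass_branch3[OF zi] z(2)
      by (intro oscillates_within_affine[OF _ Suc.IH[OF zi], of "\<lambda>_. 0" _ 2])
        (auto simp: convergent_const)
    then show ?thesis
      using p_pos oscillates_within_mono[OF _ shrink[OF p_powers(1)]] by simp
  next
    case 4
    have empty: "{y \<in> ocf_upto m. y < 0} = {}" for m by (auto simp: ocf_upto_def)
    have zero: "mass m x = 0" for m unfolding mass_def ocf_count_def 4 empty by simp
    have "0 \<le> p ^ Suc k * B" using p_pos \<open>0 \<le> B\<close> by simp
    then show ?thesis
      unfolding oscillates_within_def zero diff_self abs_zero
      by (intro allI impI exI[of _ 0] add_nonneg_pos)
  qed
qed

section \<open>The limit distribution and its functional equations\<close>

definition limit_mass :: "real \<Rightarrow> real" where
  "limit_mass x = lim (\<lambda>m. mass m x)"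

lemma mass_tendsto:
  assumes "x \<in> {0..1}"
  shows "(\<lambda>m. mass m x) \<longlonglongrightarrow> limit_mass x"
proof -
  have "Bseq total_mass"
    using total_mass_tendsto by (intro convergent_imp_Bseq) (auto simp: convergent_def)
  then obtain B where "\<And>m. \<bar>total_mass m\<bar> \<le> B" by (auto simp: Bseq_def)
  then have "total_mass m \<le> B" for m by (meson abs_le_D1)
  then have "oscillates_within (p ^ k * B) (\<lambda>m. mass m x)" for k
    using assms by (rule mass_oscillation)
  moreover have "(\<lambda>k. p ^ k * B) \<longlonglongrightarrow> 0"
    using power_tendsto_0 by (rule tendsto_mult_left_zero)
  ultimately have "convergent (\<lambda>m. mass m x)" by (rule convergent_if_oscillates_within)
  then show ?thesis by (simp add: limit_mass_def convergent_LIMSEQ_iff)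
qed

lemma limit_mass_branch3:
  assumes "x \<in> {0..1}"
  shows "limit_mass (branch3 x) = p ^ 2 * limit_mass x"
proof -
  have "branch3 x \<in> {0..1}" using assms by (auto simp: branch3_def field_simps)
  then have "(\<lambda>m. mass (m + 2) (branch3 x)) \<longlonglongrightarrow> limit_mass (branch3 x)"
    by (intro LIMSEQ_ignore_initial_segment mass_tendsto)
  then have "(\<lambda>m. p ^ 2 * mass m x) \<longlonglongrightarrow> limit_mass (branch3 x)"
    by (simp only: mass_branch3[OF assms])
  then show ?thesis
    using LIMSEQ_unique tendsto_mult_left[OF mass_tendsto[OF assms]] by blast
qed

lemma limit_mass_branch1:
  assumes "x \<in> {0..1}"
  shows "limit_mass (branch1 x) = limit_total - p * limit_mass x"
proof -
  obtain u where u: "u \<longlonglongrightarrow> limit_total" "\<And>m. mass (m + 1) (branch1 x) = u m - p * mass m x"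
    using mass_branch1[OF assms] by blast
  have "branch1 x \<in> {0..1}" using assms by (auto simp: branch1_def field_simps)
  then have "(\<lambda>m. mass (m + 1) (branch1 x)) \<longlonglongrightarrow> limit_mass (branch1 x)"
    by (intro LIMSEQ_ignore_initial_segment mass_tendsto)
  then have "(\<lambda>m. u m - p * mass m x) \<longlonglongrightarrow> limit_mass (branch1 x)"
    by (simp only: u(2))
  moreover have "(\<lambda>m. u m - p * mass m x) \<longlonglongrightarrow> limit_total - p * limit_mass x"
    by (intro tendsto_diff u(1) tendsto_mult_left mass_tendsto assms)
  ultimately show ?thesis by (rule LIMSEQ_unique)
qed

lemma ocf_dist_eq:
  assumes "x \<in> {0..1}"
  shows "ocf_dist (1 - x) = 1 - limit_mass x / limit_total"
proof -
  have eq: "ocf_dist_approx n (1 - x) = 1 - mass (Suc n) x / total_mass (Suc n)" for n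
    using p_pos by (simp add: ocf_dist_approx_count mass_def total_mass_def)
  have "(\<lambda>n. 1 - mass (Suc n) x / total_mass (Suc n)) \<longlonglongrightarrow> 1 - limit_mass x / limit_total"
    using limit_total(1) by (intro tendsto_intros LIMSEQ_Suc mass_tendsto[OF assms] total_mass_tendsto) simp
  then show ?thesis unfolding ocf_dist_def eq by (rule limI)
qed

text \<open>For positive \<open>x\<close> each application adds 2 to the reciprocal; the form used
  here also covers the fixed point 0.\<close>

lemma branch3_funpow: "0 \<le> x \<Longrightarrow> (branch3 ^^ n) x = x / (1 + 2 * real n * x)"
proof (induction n)
  case (Suc n)
  define s where "s = 1 + 2 * real n * x"
  have "0 \<le> 2 * real n * x" using Suc.prems by simp
  then have "s > 0" unfolding s_def by linarith
  then have "1 + 2 * (x / s) = (s + 2 * x) / s" by (simp add: field_simps)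
  then have "branch3 (x / s) = x / (s + 2 * x)" using \<open>s > 0\<close> by (simp add: branch3_def)
  moreover have "s + 2 * x = 1 + 2 * real (Suc n) * x" by (simp add: s_def algebra_simps)
  moreover have "(branch3 ^^ Suc n) x = branch3 (x / s)" using Suc by (simp add: s_def)
  ultimately show ?case by simp
qed simp

lemma limit_mass_branch3_funpow:
  assumes "x \<in> {0..1}"
  shows "limit_mass ((branch3 ^^ n) x) = p ^ (2 * n) * limit_mass x \<and> (branch3 ^^ n) x \<in> {0..1}"
proof (induction n)
  case (Suc n)
  have "branch3 y \<in> {0..1}" if "y \<in> {0..1}" for y
    using that by (auto simp: branch3_def field_simps)
  with Suc show ?case by (simp add: limit_mass_branch3 power2_eq_square mult_ac)
qed (use assms in simp)

end

section \<open>Size of the root and the two identities\<close>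

lemma tribonacci_root_gt_1:
  fixes lam :: real
  assumes "lam ^ 3 - lam ^ 2 - lam - 1 = 0"
  shows "1 < lam"
proof (rule ccontr)
  assume "\<not> 1 < lam"
  define u where "u = 1 - lam"
  have "u \<ge> 0" using \<open>\<not> 1 < lam\<close> by (simp add: u_def)
  have eq: "u ^ 2 * (2 - u) = 2"
    using assms by (simp add: u_def algebra_simps power2_eq_square power3_eq_cube)
  have "u < 2"
  proof (rule ccontr)
    assume "\<not> u < 2"
    then have "u ^ 2 * (2 - u) \<le> 0" by (intro mult_nonneg_nonpos) auto
    then show False using eq by simp
  qed
  \<comment> \<open>Rearranging the cubic exhibits 0 as a nonnegative plus a positive term, since
    \<open>u < 2\<close>.\<close>
  moreover have "u * (u - 1) ^ 2 + (2 - u) = 0"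
    using eq by (simp add: algebra_simps power2_eq_square)
  moreover have "0 \<le> u * (u - 1) ^ 2" using \<open>u \<ge> 0\<close> by simp
  ultimately show False by linarith
qed

theorem proposition1:
  fixes lam x :: real and n :: nat
  assumes "lam ^ 3 - lam ^ 2 - lam - 1 = 0"
    and "x \<in> {0..1}" and "n \<ge> 1"
  shows "(1 - ocf_dist (1 - x)) / lam ^ (2 * n - 1)
           = 1 / lam ^ (2 * n - 2) - 1 + ocf_dist (1 - 1 / (2 * real n - 1 + x))
       \<and> (1 - ocf_dist (1 - x)) / lam ^ (2 * n)
           = 1 - ocf_dist (1 - (if x = 0 then 0 else 1 / (2 * real n + 1 / x)))"
proof -
  have lam: "1 < lam" using assms(1) by (rule tribonacci_root_gt_1)
  define p where "p = 1 / lam"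
  interpret tribonacci_ratio p
  proof
    show "0 < p" using lam by (simp add: p_def)
    have "lam ^ 2 + lam + 1 = lam ^ 3" using assms(1) by simp
    then have "(lam ^ 2 + lam + 1) / lam ^ 3 = 1" using lam by simp
    moreover have "p + p ^ 2 + p ^ 3 = (lam ^ 2 + lam + 1) / lam ^ 3"
      using lam by (simp add: p_def field_simps power2_eq_square power3_eq_cube)
    ultimately show "p + p ^ 2 + p ^ 3 = 1" by (simp only:)
  qed
  define G where "G y = limit_mass y / limit_total" for y
  have dist: "ocf_dist (1 - y) = 1 - G y" if "y \<in> {0..1}" for y
    using ocf_dist_eq[OF that] by (simp add: G_def)
  have G1: "G (branch1 x) = 1 - p * G x"
    using limit_mass_branch1[OF assms(2)] limit_total(1) by (simp add: G_def field_simps)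
  have G3: "G ((branch3 ^^ k) y) = p ^ (2 * k) * G y" "(branch3 ^^ k) y \<in> {0..1}"
    if "y \<in> {0..1}" for y k
    using limit_mass_branch3_funpow[OF that] by (auto simp: G_def)
  obtain k where k: "n = Suc k" using assms(3) by (cases n) auto
  have b1: "branch1 x \<in> {0..1}" using assms(2) by (auto simp: branch1_def field_simps)
  \<comment> \<open>Starting from \<open>1 / (1 + x)\<close>, only \<open>n - 1\<close> iterations
    are needed: \<open>2 * k + 1\<close> equals \<open>2 * n - 1\<close>.\<close>
  have y1: "(branch3 ^^ k) (branch1 x) = 1 / (2 * real n - 1 + x)"
    using assms(2) by (subst branch3_funpow) (auto simp: branch1_def k field_simps)
  \<comment> \<open>The fixed point 0 of \<open>branch3\<close> produces exactly the convention for
    \<open>x = 0\<close>.\<close>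
  have y2: "(branch3 ^^ n) x = (if x = 0 then 0 else 1 / (2 * real n + 1 / x))"
    using assms(2) by (subst branch3_funpow) (auto simp: field_simps)
  have "ocf_dist (1 - 1 / (2 * real n - 1 + x)) = 1 - p ^ (2 * k) * (1 - p * G x)"
    using dist[OF G3(2)[OF b1]] G3(1)[OF b1] G1 unfolding y1[symmetric] by simp
  moreover have "ocf_dist (1 - (if x = 0 then 0 else 1 / (2 * real n + 1 / x))) =
      1 - p ^ (2 * n) * G x"
    using dist[OF G3(2)[OF assms(2)]] G3(1)[OF assms(2)] unfolding y2[symmetric] by simp
  moreover have "a / lam ^ j = p ^ j * a" for a j
    by (simp add: p_def power_divide)
  moreover have "2 * n - 1 = Suc (2 * k)" "2 * n - 2 = 2 * k" by (simp_all add: k)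
  ultimately show ?thesis
    using dist[OF assms(2)] by (simp only:) (simp add: algebra_simps)
qed

end
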